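(* Let $1\le k\le \ell\le r$ be integers, let $0\le e\le \ell r$, and let $B$ be any bipartite graph with a left part of $\ell$ vertices, a right part of $r$ vertices, and $e$ edges. Then $$m(B)\geq m(L_{\ell,r}(e))\quad\text{and}\quad m_k(B)\geq m_k(L_{\ell,r}(e)).$$
   Context: A matching in a graph is a set of pairwise non-incident edges (the empty set counts). $m(G)$ is the number of matchings of $G$ and $m_k(G)$ the number of matchings with exactly $k$ edges. For $\ell\le r$ and $e\le \ell r$ write $e=qr+c$ with $0\le c<r$. The lex bipartite graph $L_{\ell,r}(e)$ is the bipartite graph with parts $L$ of size $\ell$ and $R$ of size $r$ in which $q$ vertices of $L$ are adjacent to all of $R$, one further vertex of $L$ is adjacent to exactly $c$ vertices of $R$, and all other vertices of $L$ are isolated (so it has $e$ edges). *)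

theory Defs
  imports Main
begin

text \<open>Graphs are simple and undirected, given by their set of two-element edges. Matchings depend
  only on the edge set, so isolated vertices appear only in the vertex classes.\<close>

definition bipartite_graph :: "'a set \<Rightarrow> 'a set \<Rightarrow> 'a set set \<Rightarrow> bool" where
  "bipartite_graph L R E \<longleftrightarrow>
     finite L \<and> finite R \<and> L \<inter> R = {} \<and> (\<forall>d\<in>E. \<exists>x\<in>L. \<exists>y\<in>R. d = {x, y})"

definition matching :: "'a set set \<Rightarrow> 'a set set \<Rightarrow> bool" where
  "matching E M \<longleftrightarrow> M \<subseteq> E \<and> pairwise disjnt M"

definition num_matchings :: "'a set set \<Rightarrow> nat" where
  "num_matchings E = card {M. matching E M}"

definition num_matchings_of_size :: "nat \<Rightarrow> 'a set set \<Rightarrow> nat" where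
  "num_matchings_of_size k E = card {M. matching E M \<and> card M = k}"

definition lex_left :: "nat \<Rightarrow> (nat + nat) set" where
  "lex_left l = Inl ` {..<l}"

definition lex_right :: "nat \<Rightarrow> (nat + nat) set" where
  "lex_right r = Inr ` {..<r}"

text \<open>With \<open>e = q * r + c\<close> and \<open>c < r\<close>, the left vertices \<open>0, \<dots>, q - 1\<close> are joined to the whole right
  class and the left vertex \<open>q\<close> to the first \<open>c\<close> right vertices. If \<open>e = l * r\<close>, then \<open>q = l\<close>
  and \<open>c = 0\<close>, and there is no further left vertex.\<close>

definition lex_bipartite :: "nat \<Rightarrow> nat \<Rightarrow> nat \<Rightarrow> (nat + nat) set set" where
  "lex_bipartite l r e =
     {{Inl i, Inr j} | i j. i < l \<and> j < r \<and> (i < e div r \<or> i = e div r \<and> j < e mod r)}"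

lemma bipartite_graph_lex_bipartite:
  "bipartite_graph (lex_left l) (lex_right r) (lex_bipartite l r e)"
  unfolding bipartite_graph_def lex_left_def lex_right_def lex_bipartite_def by auto

lemma card_lex_bipartite:
  assumes "e \<le> l * r"
  shows "card (lex_bipartite l r e) = e"
proof (cases "r = 0")
  case True
  then show ?thesis using assms by (simp add: lex_bipartite_def)
next
  case False
  let ?f = "\<lambda>n. {Inl (n div r), Inr (n mod r)} :: (nat + nat) set"
  have lex: "(i < e div r \<or> i = e div r \<and> j < e mod r) \<longleftrightarrow> i * r + j < e" if "j < r" for i j
  proof -
    have e: "e = e div r * r + e mod r" by simp
    have "i * r + j < e" if "i < e div r"
    proof -
      have "Suc i * r \<le> e div r * r" using that by (intro mult_le_mono1) simp
      then show ?thesis using \<open>j < r\<close> e unfolding mult_Suc by linarith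
    qed
    moreover have "\<not> i * r + j < e" if "i > e div r"
    proof -
      have "Suc (e div r) * r \<le> i * r" using that by (intro mult_le_mono1) simp
      moreover have "e mod r < r" using False by simp
      ultimately show ?thesis using e unfolding mult_Suc by linarith
    qed
    moreover have "i * r + j < e \<longleftrightarrow> j < e mod r" if "i = e div r"
      using e unfolding that by linarith
    ultimately show ?thesis by (metis linorder_neqE_nat)
  qed
  have "lex_bipartite l r e = ?f ` {..<e}"
  proof (intro equalityI subsetI)
    fix d assume "d \<in> lex_bipartite l r e"
    then obtain i j where d: "d = {Inl i, Inr j}" "j < r" "i * r + j < e"
      unfolding lex_bipartite_def using lex by blast
    have "d = ?f (i * r + j)" using d by simp
    then show "d \<in> ?f ` {..<e}" using d by blast
  next
    fix d assume "d \<in> ?f ` {..<e}"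
    then obtain n where n: "n < e" "d = ?f n" by blast
    have "n div r < l" using n(1) assms by (simp add: less_mult_imp_div_less)
    moreover have m: "n mod r < r" using False by simp
    moreover have "n div r * r + n mod r < e" using n by simp
    ultimately show "d \<in> lex_bipartite l r e"
      unfolding lex_bipartite_def using n lex[OF m] by blast
  qed
  moreover have "inj_on ?f {..<e}"
    by (rule inj_onI) (auto simp: doubleton_eq_iff, metis div_mult_mod_eq)
  ultimately show ?thesis by (simp add: card_image)
qed

end

theory Submission
  imports Defs
begin

text \<open>Deleting the endpoints of an edge \<open>xy\<close> leaves \<open>e + 1 - d(x) - d(y)\<close> edges on classes of sizes
  \<open>l - 1 \<le> r - 1\<close>, and \<open>k * m\<^sub>k(B)\<close> is the sum of the resulting \<open>m\<^bsub>k-1\<^esub>\<close> over all edges \<open>xy\<close>. The number of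
  \<open>k\<close>-matchings of the lex graph is a convex piecewise linear function of \<open>e\<close>, and for the lex graph
  all the reduced edge counts lie in one linear piece. Bounding from below by the corresponding
  tangent line, induction on \<open>k\<close> reduces the claim to the fact that the lex graph maximises
  the sum of the squared degrees.

  For the latter, \<open>\<Sum>\<^sub>y d(y)\<^sup>2 = \<Sum>\<^bsub>x,x'\<^esub> |N(x) \<inter> N(x')| \<le> \<Sum>\<^bsub>x,x'\<^esub> min (d(x)) (d(x'))\<close>, so one may pass to the Ferrers
  board of the left degrees, where the sum of squares is the sum of \<open>2 * (i + j + 1)\<close> over the cells
  \<open>(i, j)\<close>. If the last row is empty, drop it; otherwise the first column is full and can be removed
  by induction, transposing the rest of the board when \<open>l = r\<close>.\<close>

section \<open>Rook placements and their recursions\<close>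

text \<open>An edge from the left vertex \<open>x\<close> to the right vertex \<open>y\<close> is
  the cell \<open>(x, y)\<close> of a board. Matchings become sets of non-attacking rooks, and
  deleting both endpoints of an edge becomes deleting a row and a column.\<close>

definition rooks :: "('a \<times> 'b) set \<Rightarrow> nat \<Rightarrow> ('a \<times> 'b) set set" where
  "rooks E k = {M. M \<subseteq> E \<and> inj_on fst M \<and> inj_on snd M \<and> card M = k}"

definition avoid :: "('a \<times> 'b) set \<Rightarrow> 'a \<times> 'b \<Rightarrow> ('a \<times> 'b) set" where
  "avoid E p = {p' \<in> E. fst p' \<noteq> fst p \<and> snd p' \<noteq> snd p}"

lemma finite_rooks: "finite E \<Longrightarrow> finite (rooks E k)"
  by (rule finite_subset[of _ "Pow E"]) (auto simp: rooks_def)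

lemma finite_avoid: "finite E \<Longrightarrow> finite (avoid E p)"
  by (simp add: avoid_def)

lemma rooks_0: "finite E \<Longrightarrow> rooks E 0 = {{}}"
  by (auto simp: rooks_def dest: finite_subset)

lemma rooks_empty_Suc: "rooks {} (Suc k) = {}"
  by (auto simp: rooks_def)

lemma card_rooks_containing:
  assumes "finite E" "p \<in> E"
  shows "card {M \<in> rooks E (Suc k). p \<in> M} = card (rooks (avoid E p) k)"
proof (rule bij_betw_same_card[where f = "\<lambda>M. M - {p}"], rule bij_betw_byWitness[where f' = "insert p"])
  have fin: "finite M" if "M \<subseteq> E" for M using that assms(1) finite_subset by blast
  show "\<forall>M\<in>{M \<in> rooks E (Suc k). p \<in> M}. insert p (M - {p}) = M" by auto
  show "\<forall>M\<in>rooks (avoid E p) k. insert p M - {p} = M"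
    by (auto simp: rooks_def avoid_def)
  show "(\<lambda>M. M - {p}) ` {M \<in> rooks E (Suc k). p \<in> M} \<subseteq> rooks (avoid E p) k"
  proof clarify
    fix M assume M: "M \<in> rooks E (Suc k)" "p \<in> M"
    then have "fst p' \<noteq> fst p \<and> snd p' \<noteq> snd p" if "p' \<in> M" "p' \<noteq> p" for p'
      using that unfolding rooks_def inj_on_def by blast
    then show "M - {p} \<in> rooks (avoid E p) k"
      using M fin[of M] by (auto simp: rooks_def avoid_def intro: inj_on_subset)
  qed
  show "insert p ` rooks (avoid E p) k \<subseteq> {M \<in> rooks E (Suc k). p \<in> M}"
  proof clarify
    fix M assume M: "M \<in> rooks (avoid E p) k"
    then have sub: "M \<subseteq> E" and av: "fst p \<notin> fst ` M" "snd p \<notin> snd ` M"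
      by (force simp: rooks_def avoid_def)+
    then have "p \<notin> M" by blast
    then show "insert p M \<in> rooks E (Suc k) \<and> p \<in> insert p M"
      using M av sub fin[OF sub] assms(2) by (auto simp: rooks_def)
  qed
qed

text \<open>Double counting of the pairs formed by a placement and one of its rooks.\<close>

lemma sum_card_rooks_avoid:
  assumes "finite E"
  shows "(\<Sum>p\<in>E. card (rooks (avoid E p) k)) = Suc k * card (rooks E (Suc k))"
proof -
  have "(\<Sum>p\<in>E. card (rooks (avoid E p) k)) = (\<Sum>p\<in>E. card {M \<in> rooks E (Suc k). p \<in> M})"
    using assms by (simp add: card_rooks_containing)
  also have "\<dots> = (\<Sum>M\<in>rooks E (Suc k). card {p \<in> E. p \<in> M})"
    using sum.swap_restrict[OF assms finite_rooks[OF assms, of "Suc k"],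
        of "\<lambda>_ _. 1 :: nat" "\<lambda>p M. p \<in> M"] by simp
  also have "\<dots> = (\<Sum>M\<in>rooks E (Suc k). Suc k)"
  proof (rule sum.cong)
    fix M assume "M \<in> rooks E (Suc k)"
    moreover from this have "{p \<in> E. p \<in> M} = M" by (auto simp: rooks_def)
    ultimately show "card {p \<in> E. p \<in> M} = Suc k" by (simp add: rooks_def)
  qed simp
  finally show ?thesis by simp
qed

text \<open>A placement leaves row \<open>x\<close> empty or has exactly one rook there, which
  blocks its column in \<open>E\<close>.\<close>

lemma card_rooks_insert_row:
  assumes "finite E" "finite Y" "x \<notin> fst ` E"
  shows "card (rooks (E \<union> {x} \<times> Y) (Suc k)) =
    card (rooks E (Suc k)) + (\<Sum>y\<in>Y. card (rooks {p \<in> E. snd p \<noteq> y} k))"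
proof -
  let ?F = "E \<union> {x} \<times> Y"
  let ?C = "\<lambda>y. {M \<in> rooks ?F (Suc k). (x, y) \<in> M}"
  have fin: "finite ?F" using assms by simp
  have split: "rooks ?F (Suc k) = rooks E (Suc k) \<union> (\<Union>y\<in>Y. ?C y)"
    by (auto simp: rooks_def)
  have "rooks E (Suc k) \<inter> (\<Union>y\<in>Y. ?C y) = {}"
    using assms(3) by (force simp: rooks_def)
  then have "card (rooks ?F (Suc k)) = card (rooks E (Suc k)) + card (\<Union>y\<in>Y. ?C y)"
    using finite_rooks[OF assms(1)] finite_rooks[OF fin] assms(2)
    by (subst split) (intro card_Un_disjoint; simp)
  moreover have "card (\<Union>y\<in>Y. ?C y) = (\<Sum>y\<in>Y. card (?C y))"
  proof (rule card_UN_disjoint[OF assms(2)])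
    show "\<forall>y\<in>Y. finite (?C y)" using finite_rooks[OF fin] by simp
    show "\<forall>y\<in>Y. \<forall>y'\<in>Y. y \<noteq> y' \<longrightarrow> ?C y \<inter> ?C y' = {}"
      by (fastforce simp: rooks_def inj_on_def)
  qed
  moreover have "card (?C y) = card (rooks {p \<in> E. snd p \<noteq> y} k)" if "y \<in> Y" for y
  proof -
    have "avoid ?F (x, y) = {p \<in> E. snd p \<noteq> y}" using assms(3) by (force simp: avoid_def)
    then show ?thesis using card_rooks_containing[OF fin, of "(x, y)" k] that by simp
  qed
  ultimately show ?thesis by simp
qed

section \<open>Counting placements on rectangles and lex boards\<close>

text \<open>The falling factorial. Truncated subtraction is harmless: for \<open>k > r\<close> the
  factor 0 occurs.\<close>

fun falling :: "nat \<Rightarrow> nat \<Rightarrow> nat" where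
  "falling r 0 = 1"
| "falling r (Suc k) = r * falling (r - 1) k"

text \<open>Choose the \<open>k\<close> occupied rows, then distinct columns for them in turn. The
  induction adds one row at a time and closes by Pascal's rule.\<close>

lemma card_rooks_Times:
  assumes "finite A" "finite Y"
  shows "card (rooks (A \<times> Y) k) = (card A choose k) * falling (card Y) k"
  using assms
proof (induction A arbitrary: k Y rule: finite_induct)
  case empty
  then show ?case by (cases k) (simp_all add: rooks_0 rooks_empty_Suc)
next
  case (insert x A)
  show ?case
  proof (cases k)
    case 0
    then show ?thesis using insert.prems insert.hyps by (simp add: rooks_0)
  next
    case (Suc j)
    have "card (rooks {p \<in> A \<times> Y. snd p \<noteq> y} j) = (card A choose j) * falling (card Y - 1) j"
      if "y \<in> Y" for y
    proof -
      have "{p \<in> A \<times> Y. snd p \<noteq> y} = A \<times> (Y - {y})" by auto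
      then show ?thesis using insert.IH[of "Y - {y}" j] insert.prems that by simp
    qed
    moreover have "insert x A \<times> Y = A \<times> Y \<union> {x} \<times> Y" by auto
    ultimately show ?thesis
      using card_rooks_insert_row[of "A \<times> Y" Y x j] insert Suc
      by (simp add: image_iff algebra_simps)
  qed
qed

text \<open>The number of \<open>k\<close>-matchings of the lex graph; it does not depend on the size of the left class.\<close>

fun lex_rook :: "nat \<Rightarrow> nat \<Rightarrow> nat \<Rightarrow> nat" where
  "lex_rook 0 r e = 1"
| "lex_rook (Suc k) r e = (e div r choose Suc k) * falling r (Suc k)
     + e mod r * ((e div r choose k) * falling (r - 1) k)"

lemma card_rooks_lex:
  assumes "0 < r" "e \<le> l * r"
  shows "card (rooks {(i, j). i < l \<and> j < r \<and> (i < e div r \<or> i = e div r \<and> j < e mod r)} k)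
    = lex_rook k r e"
proof -
  define q c where "q = e div r" and "c = e mod r"
  have c: "c < r" using assms(1) by (simp add: c_def)
  have q: "q \<le> l" using div_le_mono[OF assms(2), of r] assms(1) by (simp add: q_def)
  \<comment> \<open>Cells left over after \<open>q\<close> full rows need a further row. If
    \<open>c = 0\<close>, row \<open>q\<close> may be missing, but then
    \<open>{q} \<times> {..<c}\<close> is empty.\<close>
  have ql: "q < l" if "0 < c"
  proof (rule ccontr)
    assume "\<not> q < l"
    then have "q = l" using q by simp
    then have "e = l * r + c" using div_mult_mod_eq[of e r] by (simp add: q_def c_def)
    then show False using assms(2) that by simp
  qed
  have lex: "{(i, j). i < l \<and> j < r \<and> (i < q \<or> i = q \<and> j < c)}
      = {..<q} \<times> {..<r} \<union> {q} \<times> {..<c}"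
    using q ql c by auto
  have "card (rooks ({..<q} \<times> {..<r} \<union> {q} \<times> {..<c}) k) = lex_rook k r e"
  proof (cases k)
    case 0
    then show ?thesis by (simp add: rooks_0)
  next
    case (Suc j)
    have "card (rooks {p \<in> {..<q} \<times> {..<r}. snd p \<noteq> y} j) = (q choose j) * falling (r - 1) j"
      if "y \<in> {..<c}" for y
    proof -
      have "{p \<in> {..<q} \<times> {..<r}. snd p \<noteq> y} = {..<q} \<times> ({..<r} - {y})" by auto
      then show ?thesis using card_rooks_Times[of "{..<q}" "{..<r} - {y}" j] that c by simp
    qed
    then show ?thesis
      using card_rooks_insert_row[of "{..<q} \<times> {..<r}" "{..<c}" q j] Suc
      by (simp add: image_iff card_rooks_Times q_def c_def)
  qed
  then show ?thesis using lex unfolding q_def c_def by simp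
qed

section \<open>Convexity of the lex count in the number of edges\<close>

text \<open>The increment counts the placements with a rook on the new cell: the other
  \<open>k\<close> rooks lie in the \<open>e div r\<close> full rows, outside its column. It depends
  only on \<open>e div r\<close> and is nondecreasing, whence convexity and piecewise
  linearity.\<close>

lemma lex_rook_Suc_Suc:
  assumes "0 < r"
  shows "lex_rook (Suc k) r (Suc e) = lex_rook (Suc k) r e + (e div r choose k) * falling (r - 1) k"
proof (cases "Suc (e mod r) = r")
  case True
  \<comment> \<open>The new cell completes a row, and Pascal's rule absorbs the \<open>r\<close>
    copies of the increment.\<close>
  then have "Suc e mod r = 0" "Suc e div r = Suc (e div r)"
    by (simp_all add: mod_Suc div_Suc)
  moreover obtain q c where "e div r = q" "e mod r = c" by blast
  moreover from this have "r = Suc c" using True by simp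
  ultimately show ?thesis by (simp add: algebra_simps)
next
  case False
  then have "Suc e mod r = Suc (e mod r)" "Suc e div r = e div r"
    by (simp_all add: mod_Suc div_Suc)
  then show ?thesis by (simp add: algebra_simps)
qed

text \<open>Slopes are at least \<open>s a\<close> to the right of \<open>a\<close> and at most
  \<open>s a\<close> to the left. Integers allow for \<open>n < a\<close>.\<close>

lemma convex_sequence_above_tangent:
  fixes f s :: "nat \<Rightarrow> nat"
  assumes step: "\<And>n. f (Suc n) = f n + s n" and mono: "\<And>m n. m \<le> n \<Longrightarrow> s m \<le> s n"
  shows "int (f a) + int (s a) * (int n - int a) \<le> int (f n)"
proof (cases "a \<le> n")
  case True
  then show ?thesis
  proof (induction n rule: dec_induct)
    case (step n)
    then show ?case using assms(1)[of n] mono[of a n] by (simp add: algebra_simps)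
  qed simp
next
  case False
  then have "n \<le> a" by simp
  then show ?thesis
  proof (induction n rule: inc_induct)
    case (step n)
    then show ?case using assms(1)[of n] mono[of n a] by (simp add: algebra_simps)
  qed simp
qed

text \<open>The tangent at the row boundary \<open>p * r\<close> agrees with the lex count on the
  whole piece from \<open>p * r\<close> to \<open>(p + 1) * r\<close>; this keeps the later bound
  sharp for lex graphs.\<close>

lemma lex_rook_above_tangent:
  assumes "0 < r"
  shows "int (lex_rook (Suc k) r (p * r)) + int ((p choose k) * falling (r - 1) k) * (int t - int (p * r))
    \<le> int (lex_rook (Suc k) r t)"
  using convex_sequence_above_tangent[of "lex_rook (Suc k) r"
      "\<lambda>e. (e div r choose k) * falling (r - 1) k" "p * r" t]
    lex_rook_Suc_Suc[OF assms] assms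
  by (simp add: binomial_right_mono div_le_mono mult_le_mono1)

section \<open>Maximising the sum of squared degrees\<close>

text \<open>The sum of the squared degrees of the lex graph.\<close>

definition lex_squares :: "nat \<Rightarrow> nat \<Rightarrow> nat" where
  "lex_squares r e = (e div r) * r * (r + e div r) + e mod r * (e mod r + 2 * (e div r) + 1)"

text \<open>The rows contribute \<open>q * r^2 + c^2\<close>, the columns
  \<open>r * q^2 + c * (2 * q + 1)\<close>.\<close>

lemma lex_squares_eq: "c < r \<Longrightarrow> lex_squares r (q * r + c) = q * r * (r + q) + c * (c + 2 * q + 1)"
  by (simp add: lex_squares_def)

text \<open>Putting a full row in front of a lex board gives a lex board. In terms of the weights
  \<open>2 * (i + j + 1)\<close>, the new row contributes \<open>r * (r + 1)\<close> and each of the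
  \<open>e\<close> shifted cells gains 2.\<close>

lemma lex_squares_full_row:
  assumes "0 < r"
  shows "lex_squares r e + r * (r + 1) + 2 * e = lex_squares r (e + r)"
proof -
  obtain q c where e: "e = q * r + c" and "c < r"
    using assms by (metis div_mult_mod_eq mod_less_divisor)
  moreover have "e + r = Suc q * r + c" using e by simp
  ultimately show ?thesis
    using lex_squares_eq[of c r q] lex_squares_eq[of c r "Suc q"] by (simp add: algebra_simps)
qed

text \<open>A full column put in front of a lex board need not leave a lex board; the inequality
  accounts for refilling the cells into rows of length \<open>r + 1\<close>.\<close>

lemma lex_squares_full_column:
  assumes "0 < l" "l \<le> r" "e \<le> l * r"
  shows "lex_squares r e + l * (l + 1) + 2 * e \<le> lex_squares (Suc r) (e + l)"
proof -
  define q c where "q = e div r" and "c = e mod r"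
  have e: "e = q * r + c" by (simp add: q_def c_def)
  have c: "c < r" using assms by (simp add: c_def)
  have "q \<le> l" using div_le_mono[OF assms(3), of r] assms by (simp add: q_def)
  \<comment> \<open>\<open>m\<close> rows are not full. The other \<open>q\<close> become full rows
    of length \<open>r + 1\<close>, and \<open>c + m\<close> cells remain.\<close>
  then obtain m where l: "l = q + m" using le_Suc_ex by blast
  have m: "m = 0 \<Longrightarrow> c = 0" using assms(3) e l by simp
  have lhs: "lex_squares r e = q * r * (r + q) + c * (c + 2 * q + 1)"
    using lex_squares_eq[OF c] e by simp
  show ?thesis
  proof (cases "c + m < Suc r")
    case True
    have "e + l = q * Suc r + (c + m)" using e l by simp
    then have "lex_squares (Suc r) (e + l)
        = q * Suc r * (Suc r + q) + (c + m) * (c + m + 2 * q + 1)"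
      using lex_squares_eq[OF True] by simp
    \<comment> \<open>The two sides differ by exactly \<open>2 * c * (m - 1)\<close>.\<close>
    moreover have "c \<le> c * m" using m by (cases m) auto
    ultimately show ?thesis using lhs unfolding e l by (simp add: algebra_simps)
  next
    case False
    \<comment> \<open>The remaining cells fill one further row and \<open>d\<close> cells of the
      next; \<open>c < r\<close> and \<open>m \<le> r\<close> exclude a second full row.\<close>
    then obtain d where d: "c + m = Suc r + d" using le_Suc_ex not_less by blast
    have "d < Suc r" using d c l assms(2) by linarith
    moreover have "e + l = Suc q * Suc r + d" using e l d by simp
    ultimately have "lex_squares (Suc r) (e + l)
        = Suc q * Suc r * (Suc r + Suc q) + d * (d + 2 * Suc q + 1)"
      using lex_squares_eq[of d "Suc r" "Suc q"] by metis
    then have rhs: "int (lex_squares (Suc r) (e + l))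
        = (int q + 1) * (int r + 1) * (int r + int q + 2) + int d * (int d + 2 * int q + 3)"
      by (simp add: algebra_simps)
    have d': "int d = int c + int m - int r - 1" using d by linarith
    \<comment> \<open>The two sides differ by exactly twice this product.\<close>
    have "0 \<le> (int r - int c) * (int r + 1 - int m)"
      using c l assms(2) by (intro mult_nonneg_nonneg) auto
    then have "int (lex_squares r e + l * (l + 1) + 2 * e) \<le> int (lex_squares (Suc r) (e + l))"
      unfolding rhs lhs d' unfolding e l by (simp add: algebra_simps)
    then show ?thesis by linarith
  qed
qed

text \<open>Since \<open>n * n\<close> is the sum of the first \<open>n\<close> odd numbers, cell
  \<open>(i, j)\<close> contributes \<open>2 * j + 1\<close> to its squared row length and
  \<open>2 * i + 1\<close> to its squared column length. Induction on \<open>l + r\<close> leaves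
  room for transposing.\<close>

lemma down_set_content_le:
  fixes D :: "(nat \<times> nat) set"
  assumes "D \<subseteq> {..<l} \<times> {..<r}" "l \<le> r"
    and "\<And>i j i' j'. (i, j) \<in> D \<Longrightarrow> i' \<le> i \<Longrightarrow> j' \<le> j \<Longrightarrow> (i', j') \<in> D"
  shows "(\<Sum>(i, j)\<in>D. 2 * (i + j + 1)) \<le> lex_squares r (card D)"
  using assms
proof (induction "l + r" arbitrary: l r D rule: less_induct)
  case less
  note sub = less.prems(1) and lr = less.prems(2) and down = less.prems(3)
  have fin: "finite D" using sub finite_subset by blast
  show ?case
  proof (cases "l = 0")
    case True
    then have "D = {}" using sub by simp
    then show ?thesis by simp
  next
    case False
    then obtain l' where l': "l = Suc l'" using not0_implies_Suc by blast
    obtain r' where r': "r = Suc r'" using False lr by (cases r) auto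
    show ?thesis
    proof (cases "(l', 0) \<in> D")
      case notin: False
      have "i < l'" if "(i, j) \<in> D" for i j
      proof (rule ccontr)
        assume "\<not> i < l'"
        then show False using down[OF that, of l' 0] notin by simp
      qed
      then have "D \<subseteq> {..<l'} \<times> {..<r}" using sub by auto
      then show ?thesis using less.hyps[of l' r D] down lr l' by simp
    next
      case True
      define D' where "D' = {(i, j). (i, Suc j) \<in> D}"
      let ?sh = "\<lambda>(i :: nat, j). (i, Suc j)"
      have D: "D = {..<l} \<times> {0} \<union> ?sh ` D'"
      proof (intro equalityI subsetI)
        fix p assume "p \<in> D"
        then show "p \<in> {..<l} \<times> {0} \<union> ?sh ` D'"
          using sub by (cases p; cases "snd p") (auto simp: D'_def image_iff)
      next
        fix p assume "p \<in> {..<l} \<times> {0} \<union> ?sh ` D'"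
        then show "p \<in> D" using down[OF True] l' by (auto simp: D'_def)
      qed
      have inj: "inj_on ?sh D'" by (auto simp: inj_on_def)
      have fin': "finite D'" using fin D inj by (metis finite_Un finite_imageD)
      have disj: "({..<l} \<times> {0}) \<inter> ?sh ` D' = {}" by auto
      have card: "card D = card D' + l"
        unfolding D using fin' disj by (simp add: card_Un_disjoint card_image[OF inj])
      have "(\<Sum>(i, j)\<in>{..<l} \<times> {0}. 2 * (i + j + 1)) = (\<Sum>i<l. 2 * (i + 1) :: nat)"
        by (subst sum.cartesian_product[symmetric]) simp
      also have "\<dots> = l * (l + 1)" by (induction l) auto
      finally have col: "(\<Sum>(i, j)\<in>{..<l} \<times> {0}. 2 * (i + j + 1)) = l * (l + 1)" .
      have "(\<Sum>(i, j)\<in>?sh ` D'. 2 * (i + j + 1)) = (\<Sum>(i, j)\<in>D'. 2 * (i + j + 1) + 2)"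
        by (subst sum.reindex[OF inj]) (auto intro!: sum.cong)
      also have "\<dots> = (\<Sum>(i, j)\<in>D'. 2 * (i + j + 1)) + 2 * card D'"
        unfolding split_def by (subst sum.distrib) simp
      finally have sum: "(\<Sum>(i, j)\<in>D. 2 * (i + j + 1))
          = (\<Sum>(i, j)\<in>D'. 2 * (i + j + 1)) + l * (l + 1) + 2 * card D'"
        unfolding D using fin' disj col by (subst sum.union_disjoint) auto
      have sub': "D' \<subseteq> {..<l} \<times> {..<r'}" using sub r' by (auto simp: D'_def)
      have down': "(i', j') \<in> D'" if "(i, j) \<in> D'" "i' \<le> i" "j' \<le> j" for i j i' j'
        using that down[of i "Suc j" i' "Suc j'"] by (simp add: D'_def)
      show ?thesis
      proof (cases "l = r")
        case True
        \<comment> \<open>\<open>D'\<close> has more rows than columns, so only its transpose meets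
          the hypotheses; the removed column, of length \<open>l = r\<close>, then counts as a full
          row.\<close>
        have "(\<Sum>(i, j)\<in>prod.swap ` D'. 2 * (i + j + 1)) \<le> lex_squares r (card (prod.swap ` D'))"
        proof (rule less.hyps[of r' r])
          show "prod.swap ` D' \<subseteq> {..<r'} \<times> {..<r}" using sub' True by auto
          show "(i', j') \<in> prod.swap ` D'" if "(i, j) \<in> prod.swap ` D'" "i' \<le> i" "j' \<le> j" for i j i' j'
            using that down'[of j i j' i'] by force
        qed (use r' True in auto)
        moreover have "(\<Sum>(i, j)\<in>prod.swap ` D'. 2 * (i + j + 1)) = (\<Sum>(i, j)\<in>D'. 2 * (i + j + 1))"
          by (subst sum.reindex) (auto intro!: sum.cong)
        moreover have "card (prod.swap ` D') = card D'" by (simp add: card_image)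
        ultimately show ?thesis
          using lex_squares_full_row[of r "card D'"] r' True unfolding sum card by simp
      next
        case False
        have "card D' \<le> l * r'" using card_mono[OF _ sub'] by simp
        then have "lex_squares r' (card D') + l * (l + 1) + 2 * card D' \<le> lex_squares r (card D' + l)"
          using lex_squares_full_column[of l r' "card D'"] l' lr False r' by simp
        moreover have "(\<Sum>(i, j)\<in>D'. 2 * (i + j + 1)) \<le> lex_squares r' (card D')"
          using less.hyps[of l r' D', OF _ sub' _ down'] r' lr False by simp
        ultimately show ?thesis unfolding sum card by linarith
      qed
    qed
  qed
qed

text \<open>Summing endpoint degrees over edges yields the squared degrees of both classes. Passing
  to the Ferrers board preserves the left part and does not decrease the right part.\<close>

lemma sum_degrees_le:
  assumes E: "E \<subseteq> A \<times> Y" and fin: "finite A" "finite Y" and le: "card A \<le> card Y"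
  shows "(\<Sum>(x, y)\<in>E. card (E `` {x}) + card (E\<inverse> `` {y})) \<le> lex_squares (card Y) (card E)"
proof -
  define r where "r = card Y"
  define d where "d = (\<lambda>x. card (E `` {x}))"
  \<comment> \<open>\<open>h\<close> is the conjugate of the left degree sequence. \<open>D\<close>
    is built from columns of height \<open>h j\<close>, then swapped to put the row index
    first.\<close>
  define h where "h = (\<lambda>j. card {x \<in> A. j < d x})"
  define D where "D = (\<lambda>(j, i). (i, j)) ` (SIGMA j:{..<r}. {..<h j})"
  have row: "E `` {x} \<subseteq> Y" for x using E by auto
  have finrow: "finite (E `` {x})" for x using row fin(2) finite_subset by blast
  have d_le: "d x \<le> r" for x using row fin(2) by (simp add: d_def r_def card_mono)
  have E_Sigma: "E = (SIGMA x:A. E `` {x})" using E by auto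
  have sum_E: "(\<Sum>(x, y)\<in>E. f x y) = (\<Sum>x\<in>A. \<Sum>y\<in>E `` {x}. f x y)" for f :: "_ \<Rightarrow> _ \<Rightarrow> nat"
    using sum.Sigma[of A "\<lambda>x. E `` {x}" f] fin(1) finrow E_Sigma by simp
  have h_sum: "h j = (\<Sum>x\<in>A. of_bool (j < d x))" for j
    using fin(1) by (simp add: h_def Int_def)
  \<comment> \<open>Indicators give all sums over \<open>j\<close> the same range, so that they can
    be interchanged with sums over vertices.\<close>
  have upto: "(\<Sum>j<r. of_bool (j < n) * g j) = (\<Sum>j<n. g j)" if "n \<le> r" for n and g :: "nat \<Rightarrow> nat"
    by (rule sum.mono_neutral_cong_right) (use that in auto)
  have inj: "inj_on (\<lambda>(j, i). (i, j)) S" for S :: "(nat \<times> nat) set"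
    by (auto simp: inj_on_def)
  have "card D = (\<Sum>j<r. h j)" unfolding D_def by (simp add: card_image[OF inj])
  also have "\<dots> = (\<Sum>x\<in>A. \<Sum>j<r. of_bool (j < d x) * 1)"
    unfolding h_sum by (subst sum.swap) simp
  also have "\<dots> = (\<Sum>x\<in>A. d x)" unfolding upto[OF d_le] by simp
  also have "\<dots> = card E" using sum_E[of "\<lambda>_ _. 1"] by (simp add: d_def)
  finally have card_D: "card D = card E" .
  have "(\<Sum>(x, y)\<in>E. card (E `` {x})) = (\<Sum>x\<in>A. d x * d x)"
    unfolding sum_E by (simp add: d_def)
  also have "\<dots> = (\<Sum>x\<in>A. \<Sum>j<d x. 2 * j + 1)"
  proof (rule sum.cong)
    have "n * n = (\<Sum>j<n. 2 * j + 1)" for n :: nat by (induction n) auto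
    then show "d x * d x = (\<Sum>j<d x. 2 * j + 1)" for x .
  qed simp
  also have "\<dots> = (\<Sum>x\<in>A. \<Sum>j<r. of_bool (j < d x) * (2 * j + 1))" by (simp only: upto[OF d_le])
  also have "\<dots> = (\<Sum>j<r. h j * (2 * j + 1))"
    unfolding h_sum by (subst sum.swap) (simp only: sum_distrib_right)
  finally have rows: "(\<Sum>(x, y)\<in>E. card (E `` {x})) = (\<Sum>j<r. h j * (2 * j + 1))" .
  \<comment> \<open>Both sides count triples \<open>x\<close>, \<open>x'\<close>, \<open>y\<close>
    with \<open>y\<close> a common neighbour of \<open>x\<close> and \<open>x'\<close>.\<close>
  have "(\<Sum>(x, y)\<in>E. card (E\<inverse> `` {y})) = (\<Sum>x\<in>A. \<Sum>y\<in>E `` {x}. \<Sum>x'\<in>A. of_bool ((x', y) \<in> E))"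
  proof -
    have "card (E\<inverse> `` {y}) = (\<Sum>x'\<in>A. of_bool ((x', y) \<in> E))" for y
    proof -
      have "E\<inverse> `` {y} = A \<inter> {x'. (x', y) \<in> E}" using E by auto
      then show ?thesis using fin(1) by simp
    qed
    then show ?thesis unfolding sum_E by simp
  qed
  also have "\<dots> = (\<Sum>x\<in>A. \<Sum>x'\<in>A. card (E `` {x} \<inter> E `` {x'}))"
  proof (rule sum.cong)
    fix x
    have "E `` {x} \<inter> {y. (x', y) \<in> E} = E `` {x} \<inter> E `` {x'}" for x' by auto
    then show "(\<Sum>y\<in>E `` {x}. \<Sum>x'\<in>A. of_bool ((x', y) \<in> E)) = (\<Sum>x'\<in>A. card (E `` {x} \<inter> E `` {x'}))"
      by (subst sum.swap) (simp add: finrow)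
  qed simp
  \<comment> \<open>Equality holds for nested neighbourhoods, as in a Ferrers board.\<close>
  also have "\<dots> \<le> (\<Sum>x\<in>A. \<Sum>x'\<in>A. min (d x) (d x'))"
    by (intro sum_mono) (simp add: d_def card_mono finrow)
  also have "\<dots> = (\<Sum>x\<in>A. \<Sum>x'\<in>A. \<Sum>j<r. of_bool (j < d x) * of_bool (j < d x'))"
  proof (intro sum.cong refl)
    fix x x'
    have "(\<Sum>j<r. of_bool (j < d x) * of_bool (j < d x')) = (\<Sum>j<r. of_bool (j < min (d x) (d x')) * (1 :: nat))"
      by (intro sum.cong) auto
    also have "\<dots> = min (d x) (d x')" using d_le[of x] by (subst upto) auto
    finally show "min (d x) (d x') = (\<Sum>j<r. of_bool (j < d x) * of_bool (j < d x'))" by simp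
  qed
  also have "\<dots> = (\<Sum>x\<in>A. \<Sum>j<r. \<Sum>x'\<in>A. of_bool (j < d x) * of_bool (j < d x'))"
    by (intro sum.cong refl sum.swap)
  also have "\<dots> = (\<Sum>j<r. h j * h j)"
    unfolding h_sum sum_product by (rule sum.swap)
  finally have cols: "(\<Sum>(x, y)\<in>E. card (E\<inverse> `` {y})) \<le> (\<Sum>j<r. h j * h j)" .
  have "(\<Sum>i<n. 2 * (i + j + 1)) = n * (2 * j + 1) + n * n" for n j :: nat
    by (induction n) auto
  then have "(\<Sum>(i, j)\<in>D. 2 * (i + j + 1)) = (\<Sum>j<r. h j * (2 * j + 1) + h j * h j)"
    using sum.Sigma[of "{..<r}" "\<lambda>j. {..<h j}" "\<lambda>j i. 2 * (i + j + 1)"]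
    unfolding D_def sum.reindex[OF inj] comp_def by (simp only: split_def fst_conv snd_conv) simp
  moreover have "(\<Sum>(i, j)\<in>D. 2 * (i + j + 1)) \<le> lex_squares r (card D)"
  proof (rule down_set_content_le)
    have "h j \<le> card A" for j using fin(1) by (simp add: h_def card_mono)
    then show "D \<subseteq> {..<card A} \<times> {..<r}" by (auto simp: D_def intro: less_le_trans)
    show "(i', j') \<in> D" if "(i, j) \<in> D" "i' \<le> i" "j' \<le> j" for i j i' j'
    proof -
      have "h j \<le> h j'" unfolding h_def by (rule card_mono) (use fin(1) that(3) in auto)
      then show ?thesis using that by (auto simp: D_def image_iff)
    qed
  qed (use le r_def in simp)
  ultimately show ?thesis
    using rows cols unfolding card_D r_def by (simp add: split_def sum.distrib)
qed

section \<open>The induction on the matching size\<close>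

text \<open>The row of \<open>x\<close> and the column of \<open>y\<close> share only the cell
  \<open>(x, y)\<close>, which both degrees count.\<close>

lemma card_avoid:
  assumes "finite E" "(x, y) \<in> E"
  shows "card (avoid E (x, y)) + (card (E `` {x}) + card (E\<inverse> `` {y})) = card E + 1"
proof -
  let ?R = "{x} \<times> E `` {x}" and ?C = "E\<inverse> `` {y} \<times> {y}"
  have sub: "?R \<subseteq> E" "?C \<subseteq> E" by auto
  then have fin: "finite ?R" "finite ?C" using assms(1) finite_subset by blast+
  have "?R \<inter> ?C = {(x, y)}" using assms(2) by auto
  then have "card (?R \<union> ?C) + 1 = card ?R + card ?C"
    using card_Un_Int[OF fin] by simp
  moreover have "avoid E (x, y) = E - (?R \<union> ?C)" by (auto simp: avoid_def)
  then have "card (avoid E (x, y)) + card (?R \<union> ?C) = card E"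
    using card_Diff_subset[of "?R \<union> ?C" E] card_mono[of E "?R \<union> ?C"] fin sub assms(1) by simp
  ultimately show ?thesis by (simp add: card_cartesian_product)
qed

text \<open>The equality case: the right side is the sum, over the edges of the lex graph, of the
  tangent at \<open>p * (s + 1)\<close> evaluated at the reduced edge counts, which all lie between
  \<open>p * (s + 1)\<close> and \<open>(p + 1) * (s + 1)\<close>. Writing \<open>r = s + 2\<close>
  and \<open>q = p + 1\<close> avoids truncated subtraction.\<close>

lemma lex_rook_tangent_sum:
  fixes s p c j :: nat
  defines "r \<equiv> Suc (Suc s)"
  defines "e \<equiv> Suc p * r + c"
  assumes "c < r"
  shows "int (Suc (Suc j) * lex_rook (Suc (Suc j)) r e) =
    int e * (int (lex_rook (Suc j) (Suc s) (p * Suc s))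
      + int ((p choose j) * falling s j) * (int e + 1 - int (p * Suc s)))
    - int ((p choose j) * falling s j) * int (lex_squares r e)"
proof -
  define u X Z F where "u = int (Suc p choose Suc (Suc j))" and "X = int (p choose Suc j)"
    and "Z = int (p choose j)" and "F = int (falling s j)"
  \<comment> \<open>The absorption identities \<open>u\<close> and \<open>ZX\<close> eliminate the
    factors depending on \<open>j\<close>, leaving a polynomial identity.\<close>
  have u: "(int j + 2) * u = (int p + 1) * X"
    using arg_cong[OF Suc_times_binomial[of "Suc j" p], of int]
    unfolding u_def X_def of_nat_mult by (simp add: add.commute)
  have ZX: "(int j + 1) * (Z + X) = (int p + 1) * Z"
    using arg_cong[OF Suc_times_binomial[of j p], of int]
    by (simp add: Z_def X_def algebra_simps)
  have "int (lex_rook (Suc (Suc j)) r e)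
      = u * ((int s + 2) * ((int s + 1) * F)) + int c * ((Z + X) * ((int s + 1) * F))"
  proof -
    have "e div r = Suc p" "e mod r = c"
      using assms(3) unfolding e_def by (simp_all del: mult_Suc)
    then show ?thesis
      by (simp add: u_def X_def Z_def F_def r_def del: binomial_Suc_Suc)
        (simp add: algebra_simps)
  qed
  then have lex: "int (Suc (Suc j) * lex_rook (Suc (Suc j)) r e)
      = ((int j + 2) * u) * ((int s + 2) * ((int s + 1) * F))
        + int c * (((int j + 1) * (Z + X) + (Z + X)) * ((int s + 1) * F))"
    by (simp add: algebra_simps del: lex_rook.simps)
  have sq: "int (lex_squares r e) = (int p + 1) * (int s + 2) * (int s + 3 + int p)
      + int c * (int c + 2 * int p + 3)"
    unfolding e_def lex_squares_eq[OF assms(3)] by (simp add: r_def algebra_simps)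
  have e: "int e = (int p + 1) * (int s + 2) + int c" by (simp add: e_def r_def algebra_simps)
  have X: "int (lex_rook (Suc j) (Suc s) (p * Suc s)) = X * ((int s + 1) * F)"
    by (simp add: X_def F_def algebra_simps del: mult_Suc_right)
  have Z: "int ((p choose j) * falling s j) = Z * F" "int (p * Suc s) = int p * (int s + 1)"
    by (simp_all add: Z_def F_def algebra_simps)
  show ?thesis unfolding lex sq X Z e u ZX by (simp add: algebra_simps)
qed

text \<open>The induction ranges over all boards, because deleting an edge's endpoints shrinks both
  classes by one and keeps their sizes ordered.\<close>

lemma lex_rook_le_card_rooks:
  assumes "E \<subseteq> A \<times> Y" "finite A" "finite Y" "card A \<le> card Y"
  shows "lex_rook k (card Y) (card E) \<le> card (rooks E k)"
  using assms
proof (induction k arbitrary: A Y E)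
  case 0
  then have "finite E" by (meson finite_SigmaI finite_subset)
  then show ?case by (simp add: rooks_0)
next
  case (Suc k)
  define r e q c where "r = card Y" and "e = card E" and "q = e div r" and "c = e mod r"
  have fin: "finite E" using Suc.prems by (meson finite_SigmaI finite_subset)
  show ?case
  proof (cases k)
    case 0
    then show ?thesis
      using sum_card_rooks_avoid[OF fin, of 0] by (simp add: rooks_0 finite_avoid[OF fin])
  next
    case k: (Suc j)
    show ?thesis
    proof (cases "q = 0 \<or> r \<le> 1")
      case True
      \<comment> \<open>At least two rooks are required, which no full row or a single column cannot
        provide. As \<open>e div 0 = 0\<close>, the case \<open>r = 0\<close> falls under
        \<open>q = 0\<close>.\<close>
      have "lex_rook (Suc k) r e = 0"
      proof (cases "q = 0")
        case True
        then show ?thesis using k by (simp add: q_def)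
      next
        case False
        with True have "r = 1" by (cases r) (auto simp: q_def)
        then show ?thesis using k by simp
      qed
      then show ?thesis unfolding r_def e_def by linarith
    next
      case False
      then obtain p s where q: "q = Suc p" and r: "r = Suc (Suc s)"
        by (metis not0_implies_Suc not_less_eq_eq One_nat_def le0 le_antisym)
      have c: "c < Suc (Suc s)" using r by (simp add: c_def)
      have e: "e = Suc p * Suc (Suc s) + c"
        using div_mult_mod_eq[of e r] q r by (metis q_def c_def)
      \<comment> \<open>Value and slope of the tangent for \<open>k\<close> rooks on
        \<open>s + 1\<close> columns, at \<open>p\<close> full rows.\<close>
      define a b where "a = int (lex_rook (Suc j) (Suc s) (p * Suc s))"
        and "b = int ((p choose j) * falling s j)"
      let ?deg = "\<lambda>(x, y). card (E `` {x}) + card (E\<inverse> `` {y})"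
      have step: "a + b * (int e + 1 - int (?deg pr) - int (p * Suc s)) \<le> int (card (rooks (avoid E pr) k))"
        if "pr \<in> E" for pr
      proof -
        obtain x y where pr: "pr = (x, y)" by fastforce
        have xy: "x \<in> A" "y \<in> Y" using that Suc.prems(1) pr by auto
        have "avoid E pr \<subseteq> (A - {x}) \<times> (Y - {y})" using Suc.prems(1) pr by (auto simp: avoid_def)
        then have IH: "lex_rook k (card (Y - {y})) (card (avoid E pr)) \<le> card (rooks (avoid E pr) k)"
          using Suc.IH[of "avoid E pr" "A - {x}" "Y - {y}"] Suc.prems xy by simp
        have Y: "card (Y - {y}) = Suc s" using xy r Suc.prems(3) by (simp add: r_def)
        have deg: "int e + 1 - int (?deg pr) = int (card (avoid E pr))"
          using card_avoid[OF fin, of x y] that pr by (simp add: e_def)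
        have "a + b * (int (card (avoid E pr)) - int (p * Suc s)) \<le> int (lex_rook k (Suc s) (card (avoid E pr)))"
          using lex_rook_above_tangent[of "Suc s" j p "card (avoid E pr)"]
          unfolding a_def b_def k by simp
        then show ?thesis using IH unfolding Y deg by linarith
      qed
      have "int (Suc k * lex_rook (Suc k) r e) = int e * (a + b * (int e + 1 - int (p * Suc s)))
          - b * int (lex_squares r e)"
        using lex_rook_tangent_sum[OF c, of j p] unfolding a_def b_def k r e by simp
      \<comment> \<open>As \<open>b\<close> is nonnegative, a smaller degree sum only raises the
        bound.\<close>
      also have "\<dots> \<le> int e * (a + b * (int e + 1 - int (p * Suc s))) - b * int (\<Sum>pr\<in>E. ?deg pr)"
      proof -
        have "(\<Sum>pr\<in>E. ?deg pr) \<le> lex_squares r e"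
          using sum_degrees_le[OF Suc.prems] by (simp add: r_def e_def)
        then show ?thesis by (simp add: b_def mult_left_mono del: of_nat_sum of_nat_mult)
      qed
      also have "\<dots> = (\<Sum>pr\<in>E. a + b * (int e + 1 - int (p * Suc s)) - b * int (?deg pr))"
        by (simp add: sum_subtractf sum_distrib_left e_def del: of_nat_mult)
      also have "\<dots> = (\<Sum>pr\<in>E. a + b * (int e + 1 - int (?deg pr) - int (p * Suc s)))"
        by (intro sum.cong) (auto simp: algebra_simps)
      also have "\<dots> \<le> (\<Sum>pr\<in>E. int (card (rooks (avoid E pr) k)))"
        by (rule sum_mono) (rule step)
      also have "\<dots> = int (Suc k * card (rooks E (Suc k)))"
        unfolding sum_card_rooks_avoid[OF fin, symmetric] by simp
      finally have "Suc k * lex_rook (Suc k) r e \<le> Suc k * card (rooks E (Suc k))" by linarith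
      then show ?thesis unfolding r_def e_def by (simp only: mult_le_cancel1)
    qed
  qed
qed

section \<open>From rook placements back to matchings\<close>

text \<open>Disjoint images of the classes make the cell recoverable from its edge, and make two
  edges disjoint exactly when their cells differ in both coordinates.\<close>

lemma num_matchings_of_size_eq_card_rooks:
  assumes E: "E \<subseteq> A \<times> Y" and inj: "inj_on g A" "inj_on h Y" and disj: "g ` A \<inter> h ` Y = {}"
  shows "num_matchings_of_size k ((\<lambda>(x, y). {g x, h y}) ` E) = card (rooks E k)"
proof -
  define f where "f = (\<lambda>(x, y). {g x, h y})"
  have ne: "g x \<noteq> h y" if "x \<in> A" "y \<in> Y" for x y using that disj by blast
  have disjnt_iff: "disjnt (f p) (f p') \<longleftrightarrow> fst p \<noteq> fst p' \<and> snd p \<noteq> snd p'"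
    if "p \<in> E" "p' \<in> E" for p p'
  proof -
    obtain x y x' y' where p: "p = (x, y)" "p' = (x', y')" by fastforce
    then have mem: "x \<in> A" "y \<in> Y" "x' \<in> A" "y' \<in> Y" using that E by auto
    then show ?thesis
      using p ne[of x y'] ne[of x' y] inj by (auto simp: f_def disjnt_def inj_on_eq_iff)
  qed
  have injf: "inj_on f E"
  proof (rule inj_onI)
    fix p p' assume *: "p \<in> E" "p' \<in> E" "f p = f p'"
    obtain x y x' y' where p: "p = (x, y)" "p' = (x', y')" by fastforce
    then have mem: "x \<in> A" "y \<in> Y" "x' \<in> A" "y' \<in> Y" using * E by auto
    then have "g x = g x'" "h y = h y'"
      using * p ne[of x y'] ne[of x' y] by (auto simp: f_def doubleton_eq_iff)
    then show "p = p'" using p mem inj by (simp add: inj_on_eq_iff)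
  qed
  have iff: "matching (f ` E) (f ` M) \<and> card (f ` M) = k \<longleftrightarrow> M \<in> rooks E k" if "M \<subseteq> E" for M
  proof -
    have injM: "inj_on f M" using injf that inj_on_subset by blast
    have "pairwise disjnt (f ` M) \<longleftrightarrow> (\<forall>p\<in>M. \<forall>p'\<in>M. p \<noteq> p' \<longrightarrow> disjnt (f p) (f p'))"
      unfolding pairwise_def ball_simps by (intro ball_cong refl) (simp add: inj_on_eq_iff[OF injM])
    also have "\<dots> \<longleftrightarrow> (\<forall>p\<in>M. \<forall>p'\<in>M. p \<noteq> p' \<longrightarrow> fst p \<noteq> fst p' \<and> snd p \<noteq> snd p')"
      using that by (intro ball_cong refl) (simp add: disjnt_iff subsetD)
    also have "\<dots> \<longleftrightarrow> inj_on fst M \<and> inj_on snd M" unfolding inj_on_def by blast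
    finally show ?thesis
      using that card_image[OF injM] image_mono[OF that, of f] unfolding matching_def rooks_def by simp
  qed
  have "{N. matching (f ` E) N \<and> card N = k} = image f ` rooks E k"
  proof (intro equalityI subsetI)
    fix N assume N: "N \<in> {N. matching (f ` E) N \<and> card N = k}"
    then obtain M where "M \<subseteq> E" "N = f ` M" by (auto simp only: matching_def subset_image_iff)
    then show "N \<in> image f ` rooks E k" using N iff[of M] by blast
  next
    fix N assume "N \<in> image f ` rooks E k"
    then obtain M where M: "M \<in> rooks E k" "N = f ` M" by blast
    then have "M \<subseteq> E" by (simp add: rooks_def)
    then show "N \<in> {N. matching (f ` E) N \<and> card N = k}" using M iff[of M] by blast
  qed
  moreover have "inj_on (image f) (rooks E k)"
    using inj_on_image_Pow[OF injf] by (rule inj_on_subset) (auto simp: rooks_def)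
  ultimately show ?thesis unfolding num_matchings_of_size_def f_def[symmetric] by (simp add: card_image)
qed

lemma num_matchings_eq_sum:
  assumes "finite E"
  shows "num_matchings E = (\<Sum>k\<le>card E. num_matchings_of_size k E)"
proof -
  have sub: "{M. matching E M} \<subseteq> Pow E" by (auto simp: matching_def)
  have fin: "finite {M. matching E M}" using finite_subset[OF sub] assms by simp
  have "card M \<le> card E" if "matching E M" for M
    using that assms by (simp add: matching_def card_mono)
  then have "{M. matching E M} = (\<Union>k\<le>card E. {M. matching E M \<and> card M = k})" by auto
  then show ?thesis
    unfolding num_matchings_def num_matchings_of_size_def
    using card_UN_disjoint[of "{..card E}" "\<lambda>k. {M. matching E M \<and> card M = k}"] fin by auto
qed

lemma num_matchings_of_size_lex_bipartite:
  assumes "0 < r" "e \<le> l * r"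
  shows "num_matchings_of_size k (lex_bipartite l r e) = lex_rook k r e"
proof -
  let ?E = "{(i, j). i < l \<and> j < r \<and> (i < e div r \<or> i = e div r \<and> j < e mod r)}"
  have "lex_bipartite l r e = (\<lambda>(i, j). {Inl i, Inr j}) ` ?E"
    unfolding lex_bipartite_def by auto
  then show ?thesis
    using num_matchings_of_size_eq_card_rooks[of ?E UNIV UNIV Inl Inr k] card_rooks_lex[OF assms, of k]
    by (simp add: disjoint_iff image_iff) blast
qed

text \<open>Since \<open>L\<close> and \<open>R\<close> are disjoint, each edge has a unique
  orientation from \<open>L\<close> to \<open>R\<close>, so the board has as many cells as
  \<open>B\<close> has edges.\<close>

lemma lex_rook_le_num_matchings_of_size:
  assumes "bipartite_graph L R B" "card L \<le> card R"
  shows "lex_rook k (card R) (card B) \<le> num_matchings_of_size k B"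
proof -
  define E where "E = {(x, y). x \<in> L \<and> y \<in> R \<and> {x, y} \<in> B}"
  let ?f = "\<lambda>(x, y). {x, y}"
  have LR: "finite L" "finite R" "L \<inter> R = {}" using assms(1) by (auto simp: bipartite_graph_def)
  have E: "E \<subseteq> L \<times> R" by (auto simp: E_def)
  have B: "B = ?f ` E" using assms(1) by (fastforce simp: E_def bipartite_graph_def)
  have "inj_on ?f E" using LR(3) by (auto simp: E_def inj_on_def doubleton_eq_iff)
  then have "card B = card E" unfolding B by (rule card_image)
  moreover have "num_matchings_of_size k B = card (rooks E k)"
    using num_matchings_of_size_eq_card_rooks[OF E, of id id k] LR(3) B by simp
  ultimately show ?thesis using lex_rook_le_card_rooks[OF E LR(1,2) assms(2)] by simp
qed

theorem theorem1p3:
  fixes k l r e :: nat and L R :: "'a set" and B :: "'a set set"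
  assumes "1 \<le> k" and "k \<le> l" and "l \<le> r" and "e \<le> l * r"
    and "bipartite_graph L R B" and "card L = l" and "card R = r" and "card B = e"
  shows "num_matchings B \<ge> num_matchings (lex_bipartite l r e)
    \<and> num_matchings_of_size k B \<ge> num_matchings_of_size k (lex_bipartite l r e)"
proof -
  have "0 < r" using assms by simp
  \<comment> \<open>Every size \<open>j\<close> is covered, because the total count sums over all
    sizes; both sums run up to the common edge number \<open>e\<close>.\<close>
  then have size: "num_matchings_of_size j (lex_bipartite l r e) \<le> num_matchings_of_size j B" for j
    using lex_rook_le_num_matchings_of_size[of L R B j] assms
    by (simp add: num_matchings_of_size_lex_bipartite)
  have "B \<subseteq> Pow (L \<union> R)" using assms(5) by (auto simp: bipartite_graph_def)
  then have finB: "finite B" using assms(5) finite_subset by (fastforce simp: bipartite_graph_def)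
  have "lex_bipartite l r e \<subseteq> Pow (lex_left l \<union> lex_right r)"
    by (auto simp: lex_bipartite_def lex_left_def lex_right_def)
  then have finlex: "finite (lex_bipartite l r e)"
    by (rule finite_subset) (simp add: lex_left_def lex_right_def)
  show ?thesis
    unfolding num_matchings_eq_sum[OF finB] num_matchings_eq_sum[OF finlex]
      card_lex_bipartite[OF assms(4)] assms(8)
    using size by (auto intro: sum_mono)
qed

end
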